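(* Let $n$ be a positive integer. For any parabolic or hyperbolic linear fractional self-map $\varphi$ of $\mathbb{D}$, the equation $f_n=\varphi$ has a unique solution $f$ among the self-maps of $\mathbb{D}$. This solution $f$ is parabolic whenever $\varphi$ is parabolic and hyperbolic whenever $\varphi$ is hyperbolic. In either case, the formula for the solution is obtained as follows: if $\tau$ denotes the Denjoy-Wolff point of $\varphi$, the map $\widehat{\varphi}=T_\tau\circ\varphi\circ T_\tau^{-1}$ has the form $\widehat{\varphi}(w)=Aw+B$, a self-map of $\mathbb{H}$ with $A\ge1$ and $\mathrm{Re}\,B\ge0$. Denote by $\alpha$ the only positive $n$-th root of $A$. Then $$f(z)=T_\tau^{-1}\bigl(g(T_\tau(z))\bigr)=\tau\,\frac{g\left(\frac{\tau+z}{\tau-z}\right)-1}{g\left(\frac{\tau+z}{\tau-z}\right)+1},\quad\text{where}\quad g(w)=\alpha w+\frac{B}{\sum_{k=0}^{n-1}\alpha^k}.$$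
   Context: $\mathbb{D}$ is the open unit disk in $\mathbb{C}$ and $\mathbb{H}=\{z\in\mathbb{C}:\mathrm{Re}\,z>0\}$. A self-map of a domain $\Omega$ is an analytic function from $\Omega$ into $\Omega$. For a self-map $f$ of $\mathbb{D}$, $f_n$ denotes the $n$-th iterate: $f_1=f$, $f_{n+1}=f\circ f_n$. A linear fractional self-map of $\mathbb{D}$ is a self-map of the form $z\mapsto (az+b)/(cz+d)$ with $ad-bc\ne0$. If a non-identity self-map $h$ of $\mathbb{D}$ has no fixed point in $\mathbb{D}$, its Denjoy-Wolff point is the unique point $\tau\in\partial\mathbb{D}$ to which its iterates converge uniformly on compact subsets of $\mathbb{D}$; in this case $h$ is hyperbolic if its (angular) derivative satisfies $h'(\tau)<1$ and parabolic if $h'(\tau)=1$ (always $0<h'(\tau)\le 1$). $T_\tau(z)=\dfrac{\tau+z}{\tau-z}$, for $\tau\in\partial\mathbb{D}$, is the Cayley transform mapping $\mathbb{D}$ conformally onto $\mathbb{H}$ and $\tau$ to $\infty$. *)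

theory Defs
  imports "HOL-Complex_Analysis.Complex_Analysis"
begin

abbreviation unit_disc :: "complex set" where
  "unit_disc \<equiv> ball 0 1"

abbreviation right_half_plane :: "complex set" where
  "right_half_plane \<equiv> {w. Re w > 0}"

(* Functions are total, so only the values on S are meaningful: equality of self-maps of S
   is equality on S. *)
definition self_map :: "complex set \<Rightarrow> (complex \<Rightarrow> complex) \<Rightarrow> bool" where
  "self_map S f \<longleftrightarrow> f holomorphic_on S \<and> f ` S \<subseteq> S"

(* The denominator condition excludes the convention x / 0 = 0. *)
definition linear_fractional_self_map :: "(complex \<Rightarrow> complex) \<Rightarrow> bool" where
  "linear_fractional_self_map f \<longleftrightarrow>
     self_map unit_disc f \<and>
     (\<exists>a b c d. a * d - b * c \<noteq> 0 \<and>
        (\<forall>z\<in>unit_disc. c * z + d \<noteq> 0 \<and> f z = (a * z + b) / (c * z + d)))"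

(* Only for self-maps without a fixed point in the disc (in particular, not the identity). *)
definition denjoy_wolff_point :: "(complex \<Rightarrow> complex) \<Rightarrow> complex \<Rightarrow> bool" where
  "denjoy_wolff_point h \<tau> \<longleftrightarrow>
     self_map unit_disc h \<and> (\<forall>z\<in>unit_disc. h z \<noteq> z) \<and> \<tau> \<in> sphere 0 1 \<and>
     (\<forall>K. compact K \<and> K \<subseteq> unit_disc \<longrightarrow>
        uniform_limit K (\<lambda>k. h ^^ k) (\<lambda>_. \<tau>) sequentially)"

(* Non-tangential approach region (Stolz region) at \<tau> of aperture M. *)
definition stolz_region :: "complex \<Rightarrow> real \<Rightarrow> complex set" where
  "stolz_region \<tau> M = {z \<in> unit_disc. norm (z - \<tau>) < M * (1 - norm z)}"

(* D is the angular derivative of h at \<tau>, where \<tau> is a boundary fixed point of h; this is the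
   case for the Denjoy-Wolff point, the only point at which the notion is used. *)
definition has_angular_derivative ::
    "(complex \<Rightarrow> complex) \<Rightarrow> complex \<Rightarrow> complex \<Rightarrow> bool" where
  "has_angular_derivative h \<tau> D \<longleftrightarrow>
     (\<forall>M>1. ((\<lambda>z. (h z - \<tau>) / (z - \<tau>)) \<longlongrightarrow> D) (at \<tau> within stolz_region \<tau> M))"

definition hyperbolic :: "(complex \<Rightarrow> complex) \<Rightarrow> bool" where
  "hyperbolic h \<longleftrightarrow>
     (\<exists>\<tau> D::real. denjoy_wolff_point h \<tau> \<and>
        has_angular_derivative h \<tau> (of_real D) \<and> D < 1)"

definition parabolic :: "(complex \<Rightarrow> complex) \<Rightarrow> bool" where
  "parabolic h \<longleftrightarrow>
     (\<exists>\<tau>. denjoy_wolff_point h \<tau> \<and> has_angular_derivative h \<tau> 1)"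

definition cayley :: "complex \<Rightarrow> complex \<Rightarrow> complex" where
  "cayley \<tau> z = (\<tau> + z) / (\<tau> - z)"

(* The inverse of the conformal bijection cayley \<tau> from the disc onto the half-plane;
   meaningful on the half-plane only. *)
definition cayley_inv :: "complex \<Rightarrow> complex \<Rightarrow> complex" where
  "cayley_inv \<tau> = inv_into unit_disc (cayley \<tau>)"

end

theory Submission
  imports Defs
begin

text \<open>
  The Cayley transform that sends the Denjoy--Wolff point \<open>\<tau>\<close> to infinity turns \<open>\<phi>\<close> into a
  fixed-point-free self-map \<open>\<Phi> w = A * w + B\<close> of the right half-plane, with \<open>A\<close> real
  (\<open>linear_fractional_cayley_affine\<close>, \<open>affine_half_plane_coefficients\<close>). Orbits tend to infinity, so
  \<open>A \<ge> 1\<close>, and the angular derivative of \<open>\<phi>\<close> at \<open>\<tau>\<close> is \<open>1 / A\<close>: the map is parabolic if \<open>A = 1\<close>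
  and hyperbolic if \<open>A > 1\<close>. Among the affine maps with positive slope, \<open>\<Phi>\<close> has exactly one
  \<open>n\<close>-th root, found by comparing coefficients. Its slope is the positive root \<open>\<alpha>\<close> of \<open>A\<close>, and
  \<open>\<alpha> = 1\<close> holds exactly if \<open>A = 1\<close>. As a root of \<open>\<phi>\<close> inherits the point \<open>\<tau>\<close>
  (\<open>denjoy_wolff_point_root\<close>), it is of the same type as \<open>\<phi>\<close>.

  The substance is that every holomorphic root \<open>h\<close> of \<open>\<Phi>\<close> is affine
  (\<open>half_plane_root_of_affine_is_affine\<close>). If \<open>\<Phi>\<close> is an automorphism,
  then \<open>h\<close> preserves the hyperbolic metric, since neither \<open>h\<close> nor any of its
  iterates increases distances and \<open>h ^^ n\<close> preserves them. Otherwise \<open>\<Phi>\<close>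
  contracts the metric strictly, but it is still an isometry of a larger domain: a half-plane if
  \<open>A > 1\<close>, or the whole plane if \<open>A = 1\<close> and \<open>Re B > 0\<close>. The map
  \<open>h\<close> is not defined there, but it commutes with \<open>\<Phi>\<close>, so applying the
  Schwarz--Pick inequality far out along the orbits of \<open>\<Phi>\<close> and rescaling shows that
  \<open>h\<close> does not increase the metric of the larger domain either
  (\<open>Schwarz_Pick_commuting_affine\<close>). Hence \<open>h\<close> is an isometry of it. A
  holomorphic isometry is a Moebius map (\<open>half_plane_isometry_Moebius\<close>), and because
  \<open>h\<close> follows \<open>\<Phi>\<close> to infinity, this Moebius map fixes infinity and so is
  affine.
\<close>

section \<open>The Schwarz--Pick inequality in the half-plane\<close>

text \<open>A point of the half-plane is closer to another such point than to its mirror image: the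
  squares of the two distances differ by \<open>4 * Re w * Re a\<close>.\<close>
lemma norm_diff_less_norm_reflect:
  assumes "Re w > 0" "Re a > 0"
  shows "norm (w - a) < norm (w + cnj a)"
proof -
  have "(norm (w + cnj a))\<^sup>2 - (norm (w - a))\<^sup>2 = 4 * Re w * Re a"
    unfolding cmod_power2 by (simp add: power2_eq_square algebra_simps)
  moreover have "4 * Re w * Re a > 0" using assms by simp
  ultimately have "(norm (w - a))\<^sup>2 < (norm (w + cnj a))\<^sup>2" by linarith
  then show ?thesis by (rule power2_less_imp_less) simp
qed

text \<open>The map \<open>w \<mapsto> (w - a) / (w + cnj a)\<close> sends the half-plane onto the disc and \<open>a\<close> to \<open>0\<close>.
  Conjugating \<open>h\<close> with the maps belonging to \<open>w\<close> and \<open>h w\<close> gives a self-map of the disc that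
  fixes \<open>0\<close>, so the Schwarz lemma applies. The inequality is stated with products so that both
  sides can be rescaled before passing to a limit.\<close>
lemma Schwarz_Pick_half_plane:
  assumes h: "self_map right_half_plane h" and u: "Re u > 0" and w: "Re w > 0"
  shows "norm (h u - h w) * norm (u + cnj w) \<le> norm (u - w) * norm (h u + cnj (h w))"
proof -
  define M where "M = (\<lambda>z. (w + cnj w * z) / (1 - z))"
  define F where "F = (\<lambda>z. (h (M z) - h w) / (h (M z) + cnj (h w)))"
  have hH: "Re (h z) > 0" if "Re z > 0" for z
    using h that by (auto simp: self_map_def)
  have M_Re: "Re (M z) > 0" if "norm z < 1" for z
  proof -
    have ne: "1 - z \<noteq> 0" using that by auto
    have "Re (M z) = Re ((w + cnj w * z) * cnj (1 - z)) / (norm (1 - z))\<^sup>2"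
      unfolding M_def by (subst complex_div_cnj) (simp add: Re_divide_of_real flip: of_real_power)
    also have "Re ((w + cnj w * z) * cnj (1 - z)) = Re w * (1 - (norm z)\<^sup>2)"
      unfolding cmod_power2 by (simp add: power2_eq_square algebra_simps)
    finally have "Re (M z) = Re w * (1 - (norm z)\<^sup>2) / (norm (1 - z))\<^sup>2" .
    moreover have "(norm z)\<^sup>2 < 1" using that by (simp add: abs_square_less_1)
    ultimately show ?thesis using w ne by simp
  qed
  have denom: "h z + cnj (h w) \<noteq> 0" if "Re z > 0" for z
  proof -
    have "Re (h z + cnj (h w)) > 0" using hH[OF that] hH[OF w] by simp
    then show ?thesis by force
  qed
  have "M holomorphic_on ball 0 1"
    unfolding M_def by (intro holomorphic_intros) auto
  moreover have "h holomorphic_on M ` ball 0 1"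
  proof (rule holomorphic_on_subset)
    show "h holomorphic_on right_half_plane" using h by (simp add: self_map_def)
    show "M ` ball 0 1 \<subseteq> right_half_plane" using M_Re by (simp add: image_subset_iff)
  qed
  ultimately have "(\<lambda>z. h (M z)) holomorphic_on ball 0 1"
    using holomorphic_on_compose[of M "ball 0 1" h] by (simp add: o_def)
  then have holF: "F holomorphic_on ball 0 1"
    unfolding F_def by (intro holomorphic_intros) (use denom M_Re in auto)
  have F0: "F 0 = 0" by (simp add: F_def M_def)
  have F1: "norm (F z) < 1" if "norm z < 1" for z
    using norm_diff_less_norm_reflect[OF hH[OF M_Re[OF that]] hH[OF w]] denom[OF M_Re[OF that]]
    by (simp add: F_def norm_divide divide_simps)
  have uw: "u + cnj w \<noteq> 0" and ww: "w + cnj w \<noteq> 0"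
    using u w by (auto simp: complex_eq_iff)
  define z where "z = (u - w) / (u + cnj w)"
  have z1: "norm z < 1"
    using norm_diff_less_norm_reflect[OF u w] uw by (simp add: z_def norm_divide)
  have "1 - z = (w + cnj w) / (u + cnj w)" "w + cnj w * z = u * ((w + cnj w) / (u + cnj w))"
    using uw by (simp_all add: z_def field_simps)
  then have "M z = u" using ww uw by (simp add: M_def)
  then have "norm (h u - h w) / norm (h u + cnj (h w)) \<le> norm (u - w) / norm (u + cnj w)"
    using Schwarz_Lemma(1)[OF holF F0 F1 z1] by (simp add: F_def z_def norm_divide)
  then show ?thesis using uw denom[OF u] by (simp add: field_simps)
qed

section \<open>Self-maps of the half-plane that commute with an affine map\<close>
lemma funpow_real_affine:
  fixes A :: real and B w :: complex
  shows "((\<lambda>w. of_real A * w + B) ^^ k) w = of_real (A ^ k) * w + B * of_real (\<Sum>j<k. A ^ j)"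
proof (induction k)
  case (Suc k)
  define S where "S = (\<Sum>j<k. A ^ j)"
  have "(\<Sum>j<Suc k. A ^ j) = 1 + A * S"
    unfolding S_def by (simp only: sum.lessThan_Suc_shift) (simp add: sum_distrib_left)
  moreover have "((\<lambda>w. of_real A * w + B) ^^ Suc k) w = of_real A * (of_real (A ^ k) * w + B * of_real S) + B"
    using Suc by (simp add: S_def)
  ultimately show ?case by (simp only: of_real_add of_real_mult of_real_1 power_Suc) (simp only: algebra_simps mult_1_right)
qed simp

text \<open>This form treats \<open>A = 1\<close> and \<open>A > 1\<close> alike: in both cases the orbit of \<open>w\<close> moves along the ray
  issuing from \<open>w\<close> in the direction \<open>(A - 1) * w + B\<close>, which vanishes exactly at a fixed point.\<close>
lemma funpow_affine_increment:
  fixes A :: real and B w :: complex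
  shows "((\<lambda>w. of_real A * w + B) ^^ k) w
           = w + of_real (\<Sum>j<k. A ^ j) * (of_real (A - 1) * w + B)"
proof -
  define S where "S = (\<Sum>j<k. A ^ j)"
  have "A ^ k = 1 + (A - 1) * S"
    using power_diff_1_eq[of A k] by (simp add: S_def)
  then have "complex_of_real (A ^ k) = 1 + of_real (A - 1) * of_real S"
    by (simp only: of_real_add of_real_mult of_real_1)
  then show ?thesis unfolding funpow_real_affine S_def[symmetric] by (simp only: algebra_simps mult_1_left)
qed

text \<open>Since \<open>h\<close> commutes with \<open>\<Phi>\<close>, the Schwarz--Pick inequality for the points
  \<open>(\<Phi> ^^ k) u\<close> and \<open>(\<Phi> ^^ k) w\<close> is again an inequality between \<open>u\<close>, \<open>w\<close>, \<open>h u\<close> and \<open>h w\<close>.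
  Dividing it by \<open>A ^ k\<close> and by \<open>S k = 1 + A + \<dots> + A ^ (k - 1)\<close>, which tends to infinity,
  gives the claim in the limit. For \<open>A > 1\<close> the limit is the Schwarz--Pick inequality of the
  half-plane, possibly larger, bounded by the vertical line through the fixed point \<open>B / (1 - A)\<close> of \<open>\<Phi>\<close>; for
  \<open>A = 1\<close> and \<open>Re B > 0\<close> it says that \<open>h\<close> does not increase Euclidean distances.\<close>
lemma Schwarz_Pick_commuting_affine:
  fixes A :: real and B :: complex
  defines "\<Phi> \<equiv> (\<lambda>w. of_real A * w + B)"
  assumes h: "self_map right_half_plane h" and A: "A \<ge> 1" and B: "Re B \<ge> 0"
    and comm: "\<And>w. Re w > 0 \<Longrightarrow> h (\<Phi> w) = \<Phi> (h w)"
    and u: "Re u > 0" and w: "Re w > 0"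
  shows "norm (h u - h w) * norm (of_real (A - 1) * (u + cnj w) + 2 * of_real (Re B))
           \<le> norm (u - w) * norm (of_real (A - 1) * (h u + cnj (h w)) + 2 * of_real (Re B))"
proof -
  define S where "S = (\<lambda>k. \<Sum>j<k. A ^ j)"
  have S_ge: "S k \<ge> real k" for k
    using sum_mono[of "{..<k}" "\<lambda>_. 1" "\<lambda>j. A ^ j"] A by (simp add: S_def)
  have "filterlim S at_top sequentially"
    by (rule filterlim_at_top_mono[OF filterlim_real_sequentially]) (use S_ge in auto)
  then have invS: "(\<lambda>k. complex_of_real (1 / S k)) \<longlonglongrightarrow> of_real 0"
    by (intro tendsto_of_real tendsto_divide_0[OF tendsto_const] filterlim_at_top_imp_at_infinity)
  have \<Phi>_pos: "Re (\<Phi> z) > 0" if "Re z > 0" for z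
    using that A B by (simp add: \<Phi>_def add_pos_nonneg)
  have iter_pos: "Re ((\<Phi> ^^ k) z) > 0" if "Re z > 0" for k z
    using that \<Phi>_pos by (induction k) auto
  have iter_comm: "h ((\<Phi> ^^ k) z) = (\<Phi> ^^ k) (h z)" if "Re z > 0" for k z
    using that by (induction k) (auto simp: comm iter_pos)
  have diff: "(\<Phi> ^^ k) p - (\<Phi> ^^ k) q = of_real (A ^ k) * (p - q)" for k p q
    unfolding \<Phi>_def funpow_real_affine by (simp add: algebra_simps)
  have refl: "(\<Phi> ^^ k) p + cnj ((\<Phi> ^^ k) q)
      = of_real (S k) * (of_real (1 / S k) * (p + cnj q)
          + (of_real (A - 1) * (p + cnj q) + 2 * of_real (Re B)))"
    if "k > 0" for k p q
  proof -
    have "S k \<noteq> 0" using S_ge[of k] that by auto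
    then have "of_real (S k) * (of_real (1 / S k) * (p + cnj q)) = p + cnj q" by simp
    moreover have "2 * of_real (Re B) = B + cnj B" by (simp add: complex_add_cnj)
    moreover have "cnj (of_real (S k) * (of_real (A - 1) * q + B))
        = of_real (S k) * (of_real (A - 1) * cnj q + cnj B)" by simp
    moreover have "(\<Sum>j<k. A ^ j) = S k" by (simp add: S_def)
    ultimately show ?thesis
      unfolding \<Phi>_def funpow_affine_increment distrib_left[of "of_real (S k)" "_ * _" "_ + _"]
      by (simp only: complex_cnj_add) (simp only: algebra_simps)
  qed
  define L where "L = (\<lambda>k. norm (h u - h w) * norm (of_real (1 / S k) * (u + cnj w)
          + (of_real (A - 1) * (u + cnj w) + 2 * of_real (Re B))))"
  define R where "R = (\<lambda>k. norm (u - w) * norm (of_real (1 / S k) * (h u + cnj (h w))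
          + (of_real (A - 1) * (h u + cnj (h w)) + 2 * of_real (Re B))))"
  have "L k \<le> R k" if k: "k > 0" for k
  proof -
    have "A ^ k > 0" "S k > 0" using A S_ge[of k] k by auto
    moreover have "A ^ k * S k * L k \<le> A ^ k * S k * R k"
      using Schwarz_Pick_half_plane[OF h iter_pos[OF u, of k] iter_pos[OF w, of k]]
        \<open>A ^ k > 0\<close> \<open>S k > 0\<close> A
      unfolding iter_comm[OF u] iter_comm[OF w] diff refl[OF k] norm_mult norm_of_real L_def R_def
      by (simp add: mult_ac)
    ultimately show ?thesis by simp
  qed
  then have ev: "\<forall>\<^sub>F k in sequentially. L k \<le> R k"
    by (intro eventually_mono[OF eventually_gt_at_top[of 0]])
  have "L \<longlonglongrightarrow> norm (h u - h w) * norm (of_real 0 * (u + cnj w)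
          + (of_real (A - 1) * (u + cnj w) + 2 * of_real (Re B)))"
    unfolding L_def by (intro tendsto_intros invS)
  moreover have "R \<longlonglongrightarrow> norm (u - w) * norm (of_real 0 * (h u + cnj (h w))
          + (of_real (A - 1) * (h u + cnj (h w)) + 2 * of_real (Re B)))"
    unfolding R_def by (intro tendsto_intros invS)
  ultimately show ?thesis
    using tendsto_le[OF sequentially_bot _ _ ev] by fastforce
qed

lemma nonneg_combination_pos:
  fixes s t x :: real
  assumes "s \<ge> 0" "t \<ge> 0" "s > 0 \<or> t > 0" "x > 0"
  shows "s * x + t > 0"
  using assms by (auto intro: add_pos_nonneg add_nonneg_pos)

lemma reflected_sum_nonzero:
  fixes s t :: real
  assumes "s \<ge> 0" "t \<ge> 0" "s > 0 \<or> t > 0" "Re w > 0" "Re c > 0"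
  shows "complex_of_real s * (w + cnj c) + 2 * of_real t \<noteq> 0"
proof -
  have "Re (complex_of_real s * (w + cnj c) + 2 * of_real t) = s * (Re w + Re c) + 2 * t" by simp
  also have "\<dots> > 0" using assms by (intro nonneg_combination_pos) auto
  finally show ?thesis by force
qed

text \<open>The quotient of the two sides, as a function of \<open>w\<close> with the second point \<open>a\<close> held fixed, is
  holomorphic and unimodular on the half-plane punctured at \<open>a\<close>, hence constant. The parameters
  \<open>s\<close> and \<open>t\<close> cover two geometries: for \<open>s > 0\<close> the hyperbolic one of the half-plane
  \<open>Re w > - t / s\<close>, and for \<open>s = 0\<close> the Euclidean one.\<close>
lemma half_plane_isometry_Moebius:
  fixes s t :: real
  assumes h: "self_map right_half_plane h" and st: "s \<ge> 0" "t \<ge> 0" "s > 0 \<or> t > 0"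
    and iso: "\<And>u w. Re u > 0 \<Longrightarrow> Re w > 0 \<Longrightarrow>
        norm (h u - h w) * norm (of_real s * (u + cnj w) + 2 * of_real t)
          = norm (u - w) * norm (of_real s * (h u + cnj (h w)) + 2 * of_real t)"
    and a: "Re a > 0"
  obtains \<omega> where "\<And>w. Re w > 0 \<Longrightarrow>
      (h w - h a) * (of_real s * (w + cnj a) + 2 * of_real t)
        = \<omega> * ((w - a) * (of_real s * (h w + cnj (h a)) + 2 * of_real t))"
proof -
  define P where "P = (\<lambda>w c. complex_of_real s * (w + cnj c) + 2 * of_real t)"
  define G where "G = (\<lambda>w. (h w - h a) * P w a / ((w - a) * P (h w) (h a)))"
  have hH: "Re (h z) > 0" if "Re z > 0" for z
    using h that by (auto simp: self_map_def)
  have P0: "P w c \<noteq> 0" if "Re w > 0" "Re c > 0" for w c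
    unfolding P_def using reflected_sum_nonzero[OF st that] .
  have "connected right_half_plane" by (intro convex_connected convex_halfspace_Re_gt)
  then have conn: "connected (right_half_plane - {a})"
    by (intro connected_open_delete open_halfspace_Re_gt) auto
  have "h holomorphic_on (right_half_plane - {a})"
    using h by (auto simp: self_map_def intro: holomorphic_on_subset)
  then have hol: "G holomorphic_on (right_half_plane - {a})"
    unfolding G_def P_def
    by (intro holomorphic_intros) (use P0[OF hH hH[OF a]] in \<open>auto simp: P_def\<close>)
  have unit: "norm (G w) = 1" if "Re w > 0" "w \<noteq> a" for w
    using iso[OF that(1) a] that P0[OF hH[OF that(1)] hH[OF a]]
    by (simp add: G_def P_def norm_mult norm_divide)
  have "a + 1 \<in> right_half_plane - {a}" using a by simp
  moreover have "open (right_half_plane - {a})" by (intro open_delete open_halfspace_Re_gt)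
  ultimately have "G constant_on (right_half_plane - {a})"
    using conn hol by (intro maximum_modulus_principle[of G _ "right_half_plane - {a}" "a + 1"])
      (use unit a in auto)
  then obtain \<omega> where \<omega>: "\<And>w. Re w > 0 \<Longrightarrow> w \<noteq> a \<Longrightarrow> G w = \<omega>"
    by (auto simp: constant_on_def)
  show ?thesis
  proof (rule that)
    fix w assume w: "Re w > 0"
    show "(h w - h a) * (of_real s * (w + cnj a) + 2 * of_real t)
        = \<omega> * ((w - a) * (of_real s * (h w + cnj (h a)) + 2 * of_real t))"
    proof (cases "w = a")
      case False
      then show ?thesis using \<omega>[OF w] P0[OF hH[OF w] hH[OF a]]
        by (simp add: G_def P_def divide_eq_eq)
    qed simp
  qed
qed

text \<open>The pseudo-distance \<open>\<rho>\<close> is not increased by \<open>h\<close>, whereas \<open>\<Phi> = h ^^ n\<close> preserves it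
  because \<open>s\<close> and \<open>t\<close> satisfy the balance \<open>s * Re B = (A - 1) * t\<close>. Each of the \<open>n\<close> steps
  therefore preserves \<open>\<rho>\<close>, which makes \<open>h\<close> a Moebius map up to a unimodular constant \<open>\<omega>\<close>. As
  \<open>h\<close> commutes with \<open>\<Phi>\<close>, its values along the orbit of \<open>1\<close> are the orbit of \<open>h 1\<close>, and comparing
  both orbits gives \<open>\<omega> = 1\<close>. Then the products \<open>h w * w\<close> in the Moebius equation cancel, so it can
  be solved for \<open>h w\<close> as an affine function of \<open>w\<close>.\<close>
lemma half_plane_root_of_affine_is_affine:
  fixes A :: real and B :: complex
  assumes h: "self_map right_half_plane h" and A: "A \<ge> 1" and B: "Re B \<ge> 0"
    and nofix: "\<And>w. Re w > 0 \<Longrightarrow> of_real A * w + B \<noteq> w"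
    and root: "\<And>w. Re w > 0 \<Longrightarrow> (h ^^ n) w = of_real A * w + B"
  obtains c :: real and d :: complex
    where "c > 0" "\<And>w. Re w > 0 \<Longrightarrow> h w = of_real c * w + d"
proof -
  define \<Phi> where "\<Phi> = (\<lambda>w. of_real A * w + B)"
  \<comment> \<open>For a vertical translation, \<open>A - 1\<close> and \<open>Re B\<close> both vanish, but then \<open>\<Phi>\<close> is an automorphism
    of the half-plane itself, which preserves the quantity in the ordinary Schwarz--Pick inequality.\<close>
  define s where "s = (if A = 1 \<and> Re B = 0 then 1 else A - 1)"
  define t where "t = (if A = 1 \<and> Re B = 0 then 0 else Re B)"
  define P where "P = (\<lambda>w c. complex_of_real s * (w + cnj c) + 2 * of_real t)"
  define C where "C = (\<lambda>w. of_real (A - 1) * w + B)"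
  have st: "s \<ge> 0" "t \<ge> 0" "s > 0 \<or> t > 0"
    and s0: "s = 0 \<Longrightarrow> A = 1"
    and balance: "s * Re B + t = A * t"
    using A B by (auto simp: s_def t_def algebra_simps split: if_splits)
  have hH: "Re (h z) > 0" if "Re z > 0" for z
    using h that by (auto simp: self_map_def)
  have hkH: "Re ((h ^^ k) z) > 0" if "Re z > 0" for z k
    using that hH by (induction k) auto
  have root\<Phi>: "(h ^^ n) w = \<Phi> w" if "Re w > 0" for w
    using root[OF that] by (simp add: \<Phi>_def)
  have comm: "h (\<Phi> w) = \<Phi> (h w)" if "Re w > 0" for w
  proof -
    have "h ((h ^^ n) w) = (h ^^ n) (h w)" by (simp add: funpow_swap1)
    then show ?thesis using root\<Phi> that hH by simp
  qed
  have contract: "norm (h u - h w) * norm (P u w) \<le> norm (u - w) * norm (P (h u) (h w))"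
    if "Re u > 0" "Re w > 0" for u w
  proof (cases "A = 1 \<and> Re B = 0")
    case True
    then show ?thesis using Schwarz_Pick_half_plane[OF h that] by (simp add: P_def s_def t_def)
  next
    case False
    then have "s = A - 1" "t = Re B" by (auto simp: s_def t_def)
    then show ?thesis
      using Schwarz_Pick_commuting_affine[OF h A B comm[unfolded \<Phi>_def] that] by (simp add: P_def)
  qed
  have P0: "P w c \<noteq> 0" if "Re w > 0" "Re c > 0" for w c
    unfolding P_def using reflected_sum_nonzero[OF st that] .
  define \<rho> where "\<rho> = (\<lambda>u w. norm (u - w) / norm (P u w))"
  have \<rho>_h: "\<rho> (h u) (h w) \<le> \<rho> u w" if "Re u > 0" "Re w > 0" for u w
    using contract[OF that] P0[OF that] P0[OF hH hH, OF that] by (simp add: \<rho>_def field_simps)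
  have \<rho>_hk: "\<rho> ((h ^^ k) u) ((h ^^ k) w) \<le> \<rho> u w" if "Re u > 0" "Re w > 0" for k u w
  proof (induction k)
    case (Suc k)
    then show ?case using \<rho>_h[OF hkH hkH, OF that, of k k] by simp
  qed simp
  have \<rho>_\<Phi>: "\<rho> (\<Phi> u) (\<Phi> w) = \<rho> u w" for u w
  proof -
    have "2 * of_real (s * Re B + t) = of_real s * (B + cnj B) + 2 * of_real t"
      by (simp add: complex_add_cnj algebra_simps)
    then have "P (\<Phi> u) (\<Phi> w) = of_real A * (of_real s * (u + cnj w)) + 2 * of_real (s * Re B + t)"
      by (simp add: P_def \<Phi>_def algebra_simps)
    then have "P (\<Phi> u) (\<Phi> w) = of_real A * P u w"
      unfolding balance by (simp add: P_def algebra_simps)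
    moreover have "\<Phi> u - \<Phi> w = of_real A * (u - w)" by (simp add: \<Phi>_def algebra_simps)
    ultimately show ?thesis using A by (simp add: \<rho>_def norm_mult)
  qed
  have \<rho>_eq: "\<rho> (h u) (h w) = \<rho> u w" if "Re u > 0" "Re w > 0" for u w
  proof (cases n)
    case 0
    then show ?thesis using root[of 1] nofix[of 1] by simp
  next
    case (Suc m)
    have "(h ^^ m) (h z) = \<Phi> z" if "Re z > 0" for z
      using root\<Phi>[OF that] Suc by (simp add: funpow_swap1)
    then have "\<rho> u w \<le> \<rho> (h u) (h w)"
      using \<rho>_hk[OF hH hH, OF that, of m] \<rho>_\<Phi>[of u w] that by simp
    with \<rho>_h[OF that] show ?thesis by simp
  qed
  have iso: "norm (h u - h w) * norm (P u w) = norm (u - w) * norm (P (h u) (h w))"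
    if "Re u > 0" "Re w > 0" for u w
    using \<rho>_eq[OF that] P0[OF that] P0[OF hH hH, OF that] by (simp add: \<rho>_def field_simps)
  obtain \<omega> where \<omega>: "\<And>w. Re w > 0 \<Longrightarrow> (h w - h 1) * P w 1 = \<omega> * ((w - 1) * P (h w) (h 1))"
    using half_plane_isometry_Moebius[OF h st iso[unfolded P_def], of 1] unfolding P_def by auto
  have C0: "C w \<noteq> 0" if "Re w > 0" for w
    using nofix[OF that] by (auto simp: C_def algebra_simps)
  have "\<omega> = 1"
  proof -
    have step: "C (h 1) * (P 1 1 + of_real (s * \<sigma>) * C 1)
                 = \<omega> * (C 1 * (P (h 1) (h 1) + of_real (s * \<sigma>) * C (h 1)))"
      if k: "\<sigma> = (\<Sum>j<k. A ^ j)" "\<sigma> \<noteq> 0" for \<sigma> k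
    proof -
      have iter: "(\<Phi> ^^ k) z = z + of_real \<sigma> * C z" for z
        unfolding \<Phi>_def funpow_affine_increment k C_def ..
      have \<Phi>_pos: "Re (\<Phi> z) > 0" if "Re z > 0" for z
        using that A B by (simp add: \<Phi>_def add_pos_nonneg)
      have iter_pos: "Re ((\<Phi> ^^ i) z) > 0" if "Re z > 0" for i z
        using that \<Phi>_pos by (induction i) auto
      have "h ((\<Phi> ^^ i) 1) = (\<Phi> ^^ i) (h 1)" for i
        by (induction i) (auto simp: comm iter_pos)
      from this[of k] have "h (1 + of_real \<sigma> * C 1) = h 1 + of_real \<sigma> * C (h 1)"
        by (simp only: iter)
      then have eq: "of_real \<sigma> * C (h 1) * P (1 + of_real \<sigma> * C 1) 1
          = \<omega> * (of_real \<sigma> * C 1 * P (h 1 + of_real \<sigma> * C (h 1)) (h 1))"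
        using \<omega>[OF iter_pos[of 1 k]] by (simp add: iter)
      have "P (z + of_real \<sigma> * C z) z = P z z + of_real (s * \<sigma>) * C z" for z
        by (simp add: P_def algebra_simps)
      from eq[unfolded this] show ?thesis using k(2) by (simp only: mult_ac) simp
    qed
    \<comment> \<open>Two orbit points suffice: subtracting the equations for \<open>k = 1\<close> and \<open>k = 2\<close> removes the
      terms without \<open>s\<close>.\<close>
    have 1: "C (h 1) * (P 1 1 + of_real s * C 1) = \<omega> * (C 1 * (P (h 1) (h 1) + of_real s * C (h 1)))"
      using step[of 1 1] by (simp add: lessThan_Suc)
    have "(\<Sum>j<2. A ^ j) = 1 + A" by (simp add: lessThan_nat_numeral)
    then have 2: "C (h 1) * (P 1 1 + of_real (s * (1 + A)) * C 1)
               = \<omega> * (C 1 * (P (h 1) (h 1) + of_real (s * (1 + A)) * C (h 1)))"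
      using step[of "1 + A" 2] A by (simp del: of_real_mult of_real_add)
    show ?thesis
    proof (cases "s = 0")
      case True
      then have "A = 1" "t \<noteq> 0" using s0 st by auto
      then show ?thesis using 1 True C0[of 1] by (simp add: P_def C_def)
    next
      case False
      have "of_real (s * A) * (C 1 * C (h 1))
          = C (h 1) * (P 1 1 + of_real (s * (1 + A)) * C 1) - C (h 1) * (P 1 1 + of_real s * C 1)"
        by (simp add: algebra_simps)
      also have "\<dots> = \<omega> * (of_real (s * A) * (C 1 * C (h 1)))"
        unfolding 1 2 by (simp add: algebra_simps)
      finally have "of_real (s * A) * (C 1 * C (h 1)) = \<omega> * (of_real (s * A) * (C 1 * C (h 1)))" .
      moreover have "of_real (s * A) * (C 1 * C (h 1)) \<noteq> 0"
        using False A C0[of 1] C0[OF hH, of 1] by simp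
      ultimately show ?thesis by simp
    qed
  qed
  define c where "c = (s * Re (h 1) + t) / (s + t)"
  show ?thesis
  proof (rule that)
    have pos: "s + t > 0" using st by auto
    show "c > 0"
      using st hH[of 1] pos unfolding c_def by (intro divide_pos_pos nonneg_combination_pos) auto
    fix w assume w: "Re w > 0"
    have twice_Re: "2 * of_real (s * Re (h 1) + t) = of_real s * (h 1 + cnj (h 1)) + 2 * of_real t"
      by (simp add: complex_add_cnj algebra_simps)
    have "(h w - h 1) * P w 1 = (w - 1) * P (h w) (h 1)" using \<omega>[OF w] \<open>\<omega> = 1\<close> by simp
    then have "h w * (2 * of_real (s + t)) = w * (2 * of_real (s * Re (h 1) + t))
            + (h 1 * P 0 1 - P 0 (h 1))"
      unfolding twice_Re P_def by (simp add: algebra_simps)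
    then show "h w = of_real c * w + (h 1 * P 0 1 - P 0 (h 1)) / (2 * of_real (s + t))"
      using pos by (simp add: c_def field_simps flip: of_real_add)
  qed
qed

section \<open>Transfer between the disc and the half-plane\<close>
lemma self_map_mem: "self_map S h \<Longrightarrow> z \<in> S \<Longrightarrow> h z \<in> S"
  by (auto simp: self_map_def)

lemma self_map_funpow: "self_map S h \<Longrightarrow> self_map S (h ^^ k)"
proof (induction k)
  case 0
  then show ?case by (simp add: self_map_def id_def)
next
  case (Suc k)
  have "h \<circ> (h ^^ k) holomorphic_on S"
    using Suc by (intro holomorphic_on_compose_gen[where t = S]) (auto simp: self_map_def)
  then show ?case using Suc by (auto simp: self_map_def image_subset_iff o_def)
qed

lemma disc_ne_boundary: "norm \<tau> = 1 \<Longrightarrow> z \<in> unit_disc \<Longrightarrow> \<tau> - z \<noteq> 0"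
  by auto

lemma cayley_minus_1:
  assumes "norm \<tau> = 1" "z \<in> unit_disc"
  shows "cayley \<tau> z - 1 = 2 * z / (\<tau> - z)"
  using disc_ne_boundary[OF assms] by (simp add: cayley_def field_simps)

lemma cayley_plus_1:
  assumes "norm \<tau> = 1" "z \<in> unit_disc"
  shows "cayley \<tau> z + 1 = 2 * \<tau> / (\<tau> - z)"
  using disc_ne_boundary[OF assms] by (simp add: cayley_def field_simps)

lemma Re_cayley_pos:
  assumes \<tau>: "norm \<tau> = 1" and z: "z \<in> unit_disc"
  shows "Re (cayley \<tau> z) > 0"
proof -
  have "Re (cayley \<tau> z) = Re ((\<tau> + z) * cnj (\<tau> - z)) / (norm (\<tau> - z))\<^sup>2"
    unfolding cayley_def by (subst complex_div_cnj) (simp flip: of_real_power)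
  also have "Re ((\<tau> + z) * cnj (\<tau> - z)) = (norm \<tau>)\<^sup>2 - (norm z)\<^sup>2"
    unfolding cmod_power2 by (simp add: power2_eq_square algebra_simps)
  finally have "Re (cayley \<tau> z) = (1 - (norm z)\<^sup>2) / (norm (\<tau> - z))\<^sup>2" using \<tau> by simp
  moreover have "(norm z)\<^sup>2 < 1" using z by (simp add: abs_square_less_1)
  ultimately show ?thesis using disc_ne_boundary[OF assms] by simp
qed

lemma cayley_inv_cayley:
  assumes "norm \<tau> = 1" "z \<in> unit_disc"
  shows "cayley_inv \<tau> (cayley \<tau> z) = z"
proof -
  have "\<tau> * ((cayley \<tau> x - 1) / (cayley \<tau> x + 1)) = x" if "x \<in> unit_disc" for x
  proof -
    have "\<tau> \<noteq> 0" using assms(1) by auto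
    then show ?thesis
      using disc_ne_boundary[OF assms(1) that]
      unfolding cayley_minus_1[OF assms(1) that] cayley_plus_1[OF assms(1) that] by simp
  qed
  then have "inj_on (cayley \<tau>) unit_disc" by (intro inj_onI) metis
  then show ?thesis unfolding cayley_inv_def using assms(2) by (rule inv_into_f_f)
qed

lemma
  assumes \<tau>: "norm \<tau> = 1" and w: "Re w > 0"
  shows cayley_inv_formula: "cayley_inv \<tau> w = \<tau> * ((w - 1) / (w + 1))"
    and cayley_inv_in_disc: "cayley_inv \<tau> w \<in> unit_disc"
    and cayley_cayley_inv: "cayley \<tau> (cayley_inv \<tau> w) = w"
proof -
  define z where "z = \<tau> * ((w - 1) / (w + 1))"
  have w1: "w + 1 \<noteq> 0" using w by (auto simp: complex_eq_iff)
  have z: "z \<in> unit_disc"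
    using norm_diff_less_norm_reflect[OF w, of 1] \<tau> w1 by (simp add: z_def norm_mult norm_divide)
  have "\<tau> - z = 2 * \<tau> / (w + 1)" "\<tau> + z = 2 * \<tau> * w / (w + 1)"
    using w1 by (simp_all add: z_def field_simps)
  then have "cayley \<tau> z = w" using w1 \<tau> by (auto simp: cayley_def)
  with cayley_inv_cayley[OF \<tau> z] have "cayley_inv \<tau> w = z" by simp
  with z \<open>cayley \<tau> z = w\<close> show "cayley_inv \<tau> w = \<tau> * ((w - 1) / (w + 1))"
    "cayley_inv \<tau> w \<in> unit_disc" "cayley \<tau> (cayley_inv \<tau> w) = w"
    by (simp_all add: z_def)
qed

lemma cayley_holomorphic: "norm \<tau> = 1 \<Longrightarrow> cayley \<tau> holomorphic_on unit_disc"
  unfolding cayley_def[abs_def] by (intro holomorphic_intros) auto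

lemma cayley_inv_holomorphic:
  assumes "norm \<tau> = 1" shows "cayley_inv \<tau> holomorphic_on right_half_plane"
proof (rule holomorphic_transform)
  show "(\<lambda>w. \<tau> * ((w - 1) / (w + 1))) holomorphic_on right_half_plane"
    by (intro holomorphic_intros) (auto simp: complex_eq_iff)
qed (simp add: cayley_inv_formula[OF assms])

lemma self_map_cayley_conjugate:
  assumes \<tau>: "norm \<tau> = 1" and h: "self_map unit_disc h"
  shows "self_map right_half_plane (cayley \<tau> \<circ> h \<circ> cayley_inv \<tau>)"
  unfolding self_map_def
proof
  have "cayley \<tau> \<circ> h holomorphic_on unit_disc"
    using h cayley_holomorphic[OF \<tau>]
    by (intro holomorphic_on_compose_gen[where t = unit_disc]) (auto simp: self_map_def)
  then show "cayley \<tau> \<circ> h \<circ> cayley_inv \<tau> holomorphic_on right_half_plane"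
    using cayley_inv_in_disc[OF \<tau>]
    by (intro holomorphic_on_compose_gen[OF cayley_inv_holomorphic[OF \<tau>]]) auto
  show "(cayley \<tau> \<circ> h \<circ> cayley_inv \<tau>) ` right_half_plane \<subseteq> right_half_plane"
  proof safe
    fix w assume "Re w > 0"
    then show "Re ((cayley \<tau> \<circ> h \<circ> cayley_inv \<tau>) w) > 0"
      using Re_cayley_pos[OF \<tau> self_map_mem[OF h cayley_inv_in_disc[OF \<tau>]]] by simp
  qed
qed

lemma funpow_cayley_conjugate:
  assumes \<tau>: "norm \<tau> = 1" and h: "self_map unit_disc h" and z: "z \<in> unit_disc"
  shows "((cayley \<tau> \<circ> h \<circ> cayley_inv \<tau>) ^^ k) (cayley \<tau> z) = cayley \<tau> ((h ^^ k) z)"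
proof (induction k)
  case (Suc k)
  have "(h ^^ k) z \<in> unit_disc" using self_map_mem[OF self_map_funpow[OF h] z] .
  then show ?case using Suc by (simp add: cayley_inv_cayley[OF \<tau>])
qed simp

section \<open>Denjoy--Wolff points of iterates and of linear fractional maps\<close>
lemma denjoy_wolff_point_norm: "denjoy_wolff_point h \<tau> \<Longrightarrow> norm \<tau> = 1"
  by (simp add: denjoy_wolff_point_def)

lemma denjoy_wolff_orbit:
  assumes "denjoy_wolff_point h \<tau>" "z \<in> unit_disc"
  shows "(\<lambda>k. (h ^^ k) z) \<longlonglongrightarrow> \<tau>"
proof -
  have "uniform_limit {z} (\<lambda>k. h ^^ k) (\<lambda>_. \<tau>) sequentially"
    using assms unfolding denjoy_wolff_point_def by (meson compact_sing empty_subsetI insert_subset)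
  from tendsto_uniform_limitI[OF this, of z] show ?thesis by simp
qed

lemma denjoy_wolff_point_unique:
  assumes "denjoy_wolff_point h \<tau>" "denjoy_wolff_point h \<sigma>"
  shows "\<tau> = \<sigma>"
  using denjoy_wolff_orbit[OF assms(1), of 0] denjoy_wolff_orbit[OF assms(2), of 0]
  by (auto intro: LIMSEQ_unique)

text \<open>With \<open>k = n * q + r\<close> and \<open>r < n\<close>, the iterate \<open>h ^^ k\<close> acts on \<open>K\<close> as \<open>\<phi> ^^ q\<close> acts
  on \<open>(h ^^ r) ` K\<close>. The union of these finitely many images is compact, so a single rate of
  convergence of the iterates of \<open>\<phi>\<close> serves for all \<open>r\<close>.\<close>
lemma denjoy_wolff_point_root:
  assumes h: "self_map unit_disc h" and n: "n > 0"
    and root: "\<And>z. z \<in> unit_disc \<Longrightarrow> (h ^^ n) z = \<phi> z"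
    and \<phi>: "denjoy_wolff_point \<phi> \<tau>"
  shows "denjoy_wolff_point h \<tau>"
  unfolding denjoy_wolff_point_def
proof (intro conjI ballI allI impI)
  show "self_map unit_disc h" by fact
  show "\<tau> \<in> sphere 0 1" using \<phi> by (simp add: denjoy_wolff_point_def)
next
  fix z assume z: "z \<in> unit_disc"
  have "(h ^^ n) z = z" if "h z = z" using that by (induction n) auto
  with root[OF z] \<phi> z show "h z \<noteq> z" by (auto simp: denjoy_wolff_point_def)
next
  fix K :: "complex set" assume K: "compact K \<and> K \<subseteq> unit_disc"
  define K' where "K' = (\<Union>r<n. (h ^^ r) ` K)"
  have hk: "(h ^^ r) z \<in> unit_disc" if "z \<in> unit_disc" for r z
    using self_map_mem[OF self_map_funpow[OF h] that] .
  have iter: "(h ^^ (n * q)) z = (\<phi> ^^ q) z" if "z \<in> unit_disc" for q z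
  proof (induction q)
    case (Suc q)
    have "(h ^^ (n * Suc q)) z = (h ^^ n) ((h ^^ (n * q)) z)" by (simp add: funpow_add)
    also have "\<dots> = \<phi> ((h ^^ (n * q)) z)" using root[OF hk[OF that]] .
    finally show ?case using Suc by simp
  qed simp
  have "continuous_on K (h ^^ r)" for r
    using self_map_funpow[OF h, of r] K
    by (meson continuous_on_subset holomorphic_on_imp_continuous_on self_map_def)
  then have "compact K'"
    unfolding K'_def using K by (intro compact_UN compact_continuous_image) auto
  moreover have "K' \<subseteq> unit_disc"
    unfolding K'_def using hk K by blast
  ultimately have lim: "uniform_limit K' (\<lambda>k. \<phi> ^^ k) (\<lambda>_. \<tau>) sequentially"
    using \<phi> by (simp add: denjoy_wolff_point_def)
  show "uniform_limit K (\<lambda>k. h ^^ k) (\<lambda>_. \<tau>) sequentially"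
  proof (rule uniform_limitI)
    fix e :: real assume "e > 0"
    then obtain Q where Q: "\<And>q z. q \<ge> Q \<Longrightarrow> z \<in> K' \<Longrightarrow> dist ((\<phi> ^^ q) z) \<tau> < e"
      using uniform_limitD[OF lim, of e] unfolding eventually_sequentially by blast
    have "dist ((h ^^ k) z) \<tau> < e" if k: "k \<ge> n * Q" and z: "z \<in> K" for k z
    proof -
      have zd: "z \<in> unit_disc" using z K by auto
      have "(h ^^ (n * (k div n) + k mod n)) z = (h ^^ (n * (k div n))) ((h ^^ (k mod n)) z)"
        by (simp only: funpow_add o_apply)
      then have "(h ^^ k) z = (\<phi> ^^ (k div n)) ((h ^^ (k mod n)) z)"
        using iter[OF hk[OF zd]] by simp
      moreover have "(h ^^ (k mod n)) z \<in> K'" using z n by (auto simp: K'_def)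
      moreover have "Q \<le> k div n" using k n by (simp add: less_eq_div_iff_mult_less_eq mult.commute)
      ultimately show ?thesis using Q by simp
    qed
    then show "\<forall>\<^sub>F k in sequentially. \<forall>z\<in>K. dist ((h ^^ k) z) \<tau> < e"
      unfolding eventually_sequentially by blast
  qed
qed

text \<open>The orbit of \<open>0\<close> converges to \<open>\<tau>\<close>, and passing to the limit in \<open>\<phi> z * (c * z + d) = a * z + b\<close>
  along it shows that the formula of \<open>\<phi>\<close> fixes \<open>\<tau>\<close>. The Cayley transform moves this fixed point to
  infinity, so it turns \<open>\<phi>\<close> into an affine map.\<close>
lemma linear_fractional_cayley_affine:
  assumes lf: "linear_fractional_self_map \<phi>" and \<tau>: "denjoy_wolff_point \<phi> \<tau>"
  obtains A B :: complex where "\<And>z. z \<in> unit_disc \<Longrightarrow> cayley \<tau> (\<phi> z) = A * cayley \<tau> z + B"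
proof -
  have \<phi>: "self_map unit_disc \<phi>" using lf by (simp add: linear_fractional_self_map_def)
  obtain a b c d where det: "a * d - b * c \<noteq> 0"
    and \<phi>_eq: "\<And>z. z \<in> unit_disc \<Longrightarrow> c * z + d \<noteq> 0 \<and> \<phi> z = (a * z + b) / (c * z + d)"
    using lf by (auto simp: linear_fractional_self_map_def)
  have \<tau>1: "norm \<tau> = 1" using denjoy_wolff_point_norm[OF \<tau>] .
  define x where "x = (\<lambda>k. (\<phi> ^^ k) 0)"
  have x_lim: "x \<longlonglongrightarrow> \<tau>" unfolding x_def using denjoy_wolff_orbit[OF \<tau>] by simp
  have x: "x k \<in> unit_disc" for k
    using self_map_mem[OF self_map_funpow[OF \<phi>], of 0 k] by (simp add: x_def)
  have x_Suc: "x (Suc k) * (c * x k + d) = a * x k + b" for k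
    using \<phi>_eq[OF x[of k]] by (simp add: x_def)
  have "(\<lambda>k. x (Suc k) * (c * x k + d)) \<longlonglongrightarrow> \<tau> * (c * \<tau> + d)"
    by (intro tendsto_intros x_lim LIMSEQ_Suc)
  moreover have "(\<lambda>k. a * x k + b) \<longlonglongrightarrow> a * \<tau> + b" by (intro tendsto_intros x_lim)
  ultimately have fix_\<tau>: "\<tau> * (c * \<tau> + d) = a * \<tau> + b"
    unfolding x_Suc by (rule LIMSEQ_unique)
  then have b: "b = \<tau> * (c * \<tau> + d) - a * \<tau>" by simp
  have "a * d - b * c = (a - \<tau> * c) * (c * \<tau> + d)" unfolding b by (simp add: algebra_simps)
  with det have ac: "a - \<tau> * c \<noteq> 0" by auto
  show ?thesis
  proof (rule that)
    fix z assume z: "z \<in> unit_disc"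
    define Q where "Q = c * z + d"
    have Q: "Q \<noteq> 0" "\<phi> z = (a * z + b) / Q" using \<phi>_eq[OF z] by (simp_all add: Q_def)
    have "cayley \<tau> (\<phi> z) = (\<tau> * Q + (a * z + b)) / (\<tau> * Q - (a * z + b))"
      unfolding cayley_def Q(2) using Q(1) by (simp add: divide_simps)
    also have "\<tau> * Q - (a * z + b) = (a - \<tau> * c) * (\<tau> - z)"
      unfolding b Q_def by (simp add: algebra_simps)
    also have "\<tau> * Q + (a * z + b) = (c * \<tau> + d) * (\<tau> + z) + (d - a) * (\<tau> - z)"
      unfolding b Q_def by (simp add: algebra_simps)
    finally show "cayley \<tau> (\<phi> z)
        = (c * \<tau> + d) / (a - \<tau> * c) * cayley \<tau> z + (d - a) / (a - \<tau> * c)"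
      using ac disc_ne_boundary[OF \<tau>1 z]
      by (simp add: cayley_def add_divide_distrib[of "_ * (\<tau> + z)"])
  qed
qed

text \<open>By continuity the image of the imaginary axis lies in the closed half-plane. The image of \<open>0\<close>
  gives \<open>Re B \<ge> 0\<close>; a line that is not vertical would leave the half-plane, so \<open>A\<close> is real; and
  \<open>A < 0\<close> is impossible for large real \<open>w\<close>.\<close>
lemma affine_half_plane_coefficients:
  fixes A B :: complex
  assumes "\<And>w. Re w > 0 \<Longrightarrow> Re (A * w + B) > 0"
  shows "Im A = 0" "Re A \<ge> 0" "Re B \<ge> 0"
proof -
  have nonneg: "Re (A * Complex 0 y + B) \<ge> 0" for y
  proof (rule tendsto_lowerbound)
    show "((\<lambda>e. Re (A * Complex e y + B)) \<longlongrightarrow> Re (A * Complex 0 y + B)) (at_right 0)"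
      by (intro tendsto_intros tendsto_Complex)
    show "\<forall>\<^sub>F e in at_right 0. 0 \<le> Re (A * Complex e y + B)"
    proof (rule eventually_mono[OF eventually_at_right_less])
      fix e :: real assume "0 < e"
      then show "0 \<le> Re (A * Complex e y + B)" using assms[of "Complex e y"] by simp
    qed
  qed simp
  show B: "Re B \<ge> 0" using nonneg[of 0] by (simp add: Complex_eq_0)
  show "Im A = 0"
  proof (rule ccontr)
    assume "Im A \<noteq> 0"
    then show False using nonneg[of "(Re B + 1) / Im A"] by simp
  qed
  show "Re A \<ge> 0"
  proof (rule ccontr)
    assume "\<not> Re A \<ge> 0"
    moreover from this have "Re (of_real ((Re B + 1) / - Re A)) > 0"
      using B by (simp add: field_simps)
    ultimately show False using assms[of "of_real ((Re B + 1) / - Re A)"] by simp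
  qed
qed

text \<open>If \<open>A < 1\<close>, orbits of the affine map stay bounded in the half-plane, whereas orbits of \<open>\<phi>\<close>
  that approach \<open>\<tau>\<close> correspond to orbits that tend to infinity.\<close>
lemma cayley_affine_multiplier_ge_1:
  fixes A :: real and B :: complex
  assumes \<phi>: "denjoy_wolff_point \<phi> \<tau>" and A: "A \<ge> 0"
    and aff: "\<And>z. z \<in> unit_disc \<Longrightarrow> cayley \<tau> (\<phi> z) = of_real A * cayley \<tau> z + B"
  shows "A \<ge> 1"
proof (rule ccontr)
  assume "\<not> A \<ge> 1"
  then have A1: "A < 1" by simp
  have \<tau>1: "norm \<tau> = 1" using denjoy_wolff_point_norm[OF \<phi>] .
  have sm: "self_map unit_disc \<phi>" using \<phi> by (simp add: denjoy_wolff_point_def)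
  define x where "x = (\<lambda>k. (\<phi> ^^ k) 0)"
  have x: "x k \<in> unit_disc" for k
    using self_map_mem[OF self_map_funpow[OF sm], of 0 k] by (simp add: x_def)
  \<comment> \<open>The disc of radius \<open>norm B / (1 - A)\<close> is invariant; adding \<open>1\<close> makes it contain the
    starting point \<open>cayley \<tau> 0 = 1\<close>.\<close>
  define R where "R = 1 + norm B / (1 - A)"
  have "R \<ge> 1" using A1 by (simp add: R_def)
  moreover have "A * R + norm B = R + (A - 1)" using A1 by (simp add: R_def field_simps)
  ultimately have R: "R \<ge> 1" "A * R + norm B \<le> R" using A1 by simp_all
  have bound: "norm (cayley \<tau> (x k)) \<le> R" for k
  proof (induction k)
    case 0
    have "cayley \<tau> 0 = 1" using \<tau>1 by (auto simp: cayley_def)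
    then show ?case using R by (simp add: x_def)
  next
    case (Suc k)
    have "norm (cayley \<tau> (x (Suc k))) \<le> A * norm (cayley \<tau> (x k)) + norm B"
      using aff[OF x[of k]] A norm_triangle_ineq[of "of_real A * cayley \<tau> (x k)" B]
      by (simp add: x_def norm_mult)
    also have "\<dots> \<le> A * R + norm B" using Suc A by (simp add: mult_left_mono)
    finally show ?case using R by simp
  qed
  have far: "norm (x k - \<tau>) \<ge> 2 / (R + 1)" for k
  proof -
    have "norm (cayley \<tau> (x k) + 1) \<le> R + 1"
      using norm_triangle_ineq[of "cayley \<tau> (x k)" 1] bound[of k] by simp
    then have "2 / norm (\<tau> - x k) \<le> R + 1"
      unfolding cayley_plus_1[OF \<tau>1 x] using \<tau>1 by (simp add: norm_divide norm_mult)
    moreover have "norm (\<tau> - x k) > 0" using disc_ne_boundary[OF \<tau>1 x] by simp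
    ultimately show ?thesis using R by (simp add: field_simps norm_minus_commute)
  qed
  have "x \<longlonglongrightarrow> \<tau>" unfolding x_def using denjoy_wolff_orbit[OF \<phi>] by simp
  then have "(\<lambda>k. norm (x k - \<tau>)) \<longlonglongrightarrow> 0" by (simp add: LIM_zero tendsto_norm_zero)
  then have "2 / (R + 1) \<le> 0" by (rule LIMSEQ_le_const) (use far in auto)
  then show False using R by (simp add: field_simps)
qed

section \<open>The angular derivative is the reciprocal of the multiplier\<close>

text \<open>In terms of \<open>1 / (\<tau> - z)\<close>, of which the Cayley transform is an affine function, \<open>\<phi>\<close> is
  affine with slope \<open>A\<close>. Hence \<open>(\<phi> z - \<tau>) / (z - \<tau>)\<close> extends continuously to \<open>\<tau>\<close> with the value
  \<open>1 / A\<close>.\<close>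
lemma has_angular_derivative_cayley_affine:
  fixes A :: real and B :: complex
  assumes \<tau>: "norm \<tau> = 1" and \<phi>: "self_map unit_disc \<phi>" and A: "A \<noteq> 0"
    and aff: "\<And>z. z \<in> unit_disc \<Longrightarrow> cayley \<tau> (\<phi> z) = of_real A * cayley \<tau> z + B"
  shows "has_angular_derivative \<phi> \<tau> (of_real (1 / A))"
  unfolding has_angular_derivative_def
proof (intro allI impI)
  fix M :: real
  have quotient: "2 * \<tau> / (2 * \<tau> * of_real A + (B + 1 - of_real A) * (\<tau> - z)) = (\<phi> z - \<tau>) / (z - \<tau>)"
    if z: "z \<in> unit_disc" for z
  proof -
    define p q where "p = \<tau> - \<phi> z" and "q = \<tau> - z"
    have pq: "p \<noteq> 0" "q \<noteq> 0"
      unfolding p_def q_def using disc_ne_boundary[OF \<tau>] z self_map_mem[OF \<phi> z] by blast+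
    have "2 * \<tau> / p - 1 = of_real A * (2 * \<tau> / q - 1) + B"
      using aff[OF z] cayley_plus_1[OF \<tau> z] cayley_plus_1[OF \<tau> self_map_mem[OF \<phi> z]]
      unfolding p_def q_def by (metis add_diff_cancel_right')
    then have "2 * \<tau> * q = p * (2 * \<tau> * of_real A + (B + 1 - of_real A) * q)"
      using pq by (simp add: field_simps)
    moreover from this have "2 * \<tau> * of_real A + (B + 1 - of_real A) * q \<noteq> 0"
      using pq \<tau> by auto
    ultimately have "2 * \<tau> / (2 * \<tau> * of_real A + (B + 1 - of_real A) * q) = p / q"
      using pq by (simp add: frac_eq_eq)
    also have "p / q = (\<phi> z - \<tau>) / (z - \<tau>)"
      unfolding p_def q_def by (metis minus_diff_eq minus_divide_divide)
    finally show ?thesis by (simp add: q_def)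
  qed
  have "((\<lambda>z. 2 * \<tau> / (2 * \<tau> * of_real A + (B + 1 - of_real A) * (\<tau> - z)))
      \<longlongrightarrow> 2 * \<tau> / (2 * \<tau> * of_real A + (B + 1 - of_real A) * (\<tau> - \<tau>))) (at \<tau> within stolz_region \<tau> M)"
    using \<tau> A by (intro tendsto_intros) auto
  also have "2 * \<tau> / (2 * \<tau> * of_real A + (B + 1 - of_real A) * (\<tau> - \<tau>)) = of_real (1 / A)"
    using \<tau> by auto
  finally show "((\<lambda>z. (\<phi> z - \<tau>) / (z - \<tau>)) \<longlongrightarrow> of_real (1 / A)) (at \<tau> within stolz_region \<tau> M)"
    by (rule Lim_transform_eventually)
      (use quotient in \<open>auto simp: eventually_at_filter stolz_region_def intro!: always_eventually\<close>)
qed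

text \<open>The radius to \<open>\<tau>\<close> lies in the Stolz region of aperture \<open>2\<close>, so \<open>\<tau>\<close> is a limit point of it.\<close>
lemma angular_derivative_unique:
  assumes \<tau>: "norm \<tau> = 1"
    and "has_angular_derivative h \<tau> D" "has_angular_derivative h \<tau> E"
  shows "D = E"
proof -
  have "\<tau> islimpt stolz_region \<tau> 2"
    unfolding islimpt_approachable
  proof (intro allI impI)
    fix e :: real assume "e > 0"
    define r where "r = 1 - min 1 e / 2"
    have r: "0 < r" "r < 1" "1 - r < e" using \<open>e > 0\<close> by (auto simp: r_def)
    have "of_real r * \<tau> - \<tau> = of_real (r - 1) * \<tau>" by (simp add: algebra_simps)
    then have dist: "norm (of_real r * \<tau> - \<tau>) = 1 - r"
      using r \<tau> by (simp only: norm_mult norm_of_real) simp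
    have "of_real r * \<tau> \<in> stolz_region \<tau> 2"
      using r \<tau> dist by (simp add: stolz_region_def norm_mult)
    moreover have "of_real r * \<tau> \<noteq> \<tau>" using dist r by auto
    moreover have "dist (of_real r * \<tau>) \<tau> < e" using dist r by (simp add: dist_norm)
    ultimately show "\<exists>x'\<in>stolz_region \<tau> 2. x' \<noteq> \<tau> \<and> dist x' \<tau> < e" by blast
  qed
  then have "at \<tau> within stolz_region \<tau> 2 \<noteq> bot" by (simp add: trivial_limit_within)
  moreover have "((\<lambda>z. (h z - \<tau>) / (z - \<tau>)) \<longlongrightarrow> D) (at \<tau> within stolz_region \<tau> 2)"
    "((\<lambda>z. (h z - \<tau>) / (z - \<tau>)) \<longlongrightarrow> E) (at \<tau> within stolz_region \<tau> 2)"
    using assms(2,3) by (auto simp: has_angular_derivative_def)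
  ultimately show ?thesis by (rule tendsto_unique)
qed

lemma
  fixes A :: real and B :: complex
  assumes \<phi>: "denjoy_wolff_point \<phi> \<tau>" and A: "A \<ge> 1"
    and aff: "\<And>z. z \<in> unit_disc \<Longrightarrow> cayley \<tau> (\<phi> z) = of_real A * cayley \<tau> z + B"
  shows parabolic_iff_multiplier: "parabolic \<phi> \<longleftrightarrow> A = 1"
    and hyperbolic_iff_multiplier: "hyperbolic \<phi> \<longleftrightarrow> A > 1"
proof -
  have \<tau>1: "norm \<tau> = 1" using denjoy_wolff_point_norm[OF \<phi>] .
  have sm: "self_map unit_disc \<phi>" using \<phi> by (simp add: denjoy_wolff_point_def)
  have der: "has_angular_derivative \<phi> \<tau> (of_real (1 / A))"
    using has_angular_derivative_cayley_affine[OF \<tau>1 sm _ aff] A by simp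
  have der_iff: "has_angular_derivative \<phi> \<tau> D \<longleftrightarrow> D = of_real (1 / A)" for D
    using der angular_derivative_unique[OF \<tau>1 _ der] by metis
  have dw_iff: "denjoy_wolff_point \<phi> \<sigma> \<longleftrightarrow> \<sigma> = \<tau>" for \<sigma>
    using \<phi> denjoy_wolff_point_unique[OF \<phi>] by metis
  have "parabolic \<phi> \<longleftrightarrow> complex_of_real 1 = of_real (1 / A)"
    unfolding parabolic_def dw_iff by (simp add: der_iff)
  then show "parabolic \<phi> \<longleftrightarrow> A = 1" unfolding of_real_eq_iff using A by auto
  have "hyperbolic \<phi> \<longleftrightarrow> 1 / A < 1"
    unfolding hyperbolic_def dw_iff by (auto simp: der_iff simp del: of_real_divide)
  then show "hyperbolic \<phi> \<longleftrightarrow> A > 1" using A by simp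
qed

section \<open>Existence and uniqueness of the root\<close>

text \<open>In the half-plane the root is \<open>w \<mapsto> c * w + d\<close> with \<open>c > 0\<close>, and its \<open>n\<close>-th iterate is
  \<open>c ^ n * w + d * (\<Sum>j<n. c ^ j)\<close>. Comparing coefficients determines \<open>c\<close> and \<open>d\<close>.\<close>
lemma disc_root_of_affine_unique:
  fixes A \<alpha> :: real and B :: complex
  assumes n: "n > 0" and \<tau>: "norm \<tau> = 1"
    and A: "A \<ge> 1" and B: "Re B \<ge> 0" and \<alpha>: "\<alpha> > 0" "\<alpha> ^ n = A"
    and nofix: "\<And>z. z \<in> unit_disc \<Longrightarrow> \<phi> z \<noteq> z"
    and aff: "\<And>z. z \<in> unit_disc \<Longrightarrow> cayley \<tau> (\<phi> z) = of_real A * cayley \<tau> z + B"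
    and h: "self_map unit_disc h" and root: "\<And>z. z \<in> unit_disc \<Longrightarrow> (h ^^ n) z = \<phi> z"
    and z: "z \<in> unit_disc"
  shows "cayley \<tau> (h z) = of_real \<alpha> * cayley \<tau> z + B / of_real (\<Sum>j<n. \<alpha> ^ j)"
proof -
  define k where "k = cayley \<tau> \<circ> h \<circ> cayley_inv \<tau>"
  have k_root: "(k ^^ n) w = of_real A * w + B" if w: "Re w > 0" for w
  proof -
    have D: "cayley_inv \<tau> w \<in> unit_disc" using cayley_inv_in_disc[OF \<tau> w] .
    show ?thesis
      using funpow_cayley_conjugate[OF \<tau> h D, of n]
      by (simp add: k_def root[OF D] aff[OF D] cayley_cayley_inv[OF \<tau> w])
  qed
  have k_nofix: "of_real A * w + B \<noteq> w" if w: "Re w > 0" for w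
  proof
    have D: "cayley_inv \<tau> w \<in> unit_disc" using cayley_inv_in_disc[OF \<tau> w] .
    assume "of_real A * w + B = w"
    then have "cayley \<tau> (\<phi> (cayley_inv \<tau> w)) = w"
      using aff[OF D] by (simp add: cayley_cayley_inv[OF \<tau> w])
    moreover have "\<phi> (cayley_inv \<tau> w) \<in> unit_disc"
      using self_map_mem[OF self_map_funpow[OF h] D] root[OF D] by metis
    ultimately have "\<phi> (cayley_inv \<tau> w) = cayley_inv \<tau> w"
      using cayley_inv_cayley[OF \<tau>] by metis
    with nofix[OF D] show False by simp
  qed
  obtain c :: real and d where c: "c > 0" and k_aff: "\<And>w. Re w > 0 \<Longrightarrow> k w = of_real c * w + d"
    using half_plane_root_of_affine_is_affine[OF self_map_cayley_conjugate[OF \<tau> h, folded k_def]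
        A B k_nofix k_root] by blast
  have kH: "Re (k w) > 0" if "Re w > 0" for w
    using self_map_cayley_conjugate[OF \<tau> h] that by (auto simp: self_map_def k_def)
  have k_funpow: "Re ((k ^^ i) w) > 0 \<and> (k ^^ i) w = ((\<lambda>w. of_real c * w + d) ^^ i) w"
    if "Re w > 0" for w i
    using that by (induction i) (auto simp: kH k_aff[symmetric])
  have eq: "of_real (c ^ n) * w + d * of_real (\<Sum>j<n. c ^ j) = of_real A * w + B" if "Re w > 0" for w
    using k_funpow[OF that, of n] k_root[OF that] by (simp only: funpow_real_affine)
  have slope: "X = Y" if "X * 1 + E = Y * 1 + F" "X * 2 + E = Y * 2 + F" for X Y E F :: complex
  proof -
    have "X * 2 + E - (X * 1 + E) = Y * 2 + F - (Y * 1 + F)" by (simp only: that)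
    then show ?thesis by simp
  qed
  have "complex_of_real (c ^ n) = of_real A"
    by (rule slope[OF eq eq]) simp_all
  then have "c ^ n = \<alpha> ^ n" using \<alpha> by (simp only: of_real_eq_iff)
  then have "c = \<alpha>" using c \<alpha> n by (metis less_imp_le power_eq_imp_eq_base)
  moreover have "(\<Sum>j<n. c ^ j) > 0" using c n by (intro sum_pos) auto
  then have "d = B / of_real (\<Sum>j<n. c ^ j)"
    using eq[of 1] \<open>complex_of_real (c ^ n) = of_real A\<close>
    by (simp add: field_simps del: of_real_power of_real_sum)
  moreover have "cayley \<tau> (h z) = k (cayley \<tau> z)"
    by (simp add: k_def cayley_inv_cayley[OF \<tau> z])
  ultimately show ?thesis using k_aff[OF Re_cayley_pos[OF \<tau> z]] by simp
qed

lemma disc_root_of_affine_exists: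
  fixes A \<alpha> :: real and B :: complex
  assumes n: "n > 0" and \<tau>: "norm \<tau> = 1" and B: "Re B \<ge> 0" and \<alpha>: "\<alpha> > 0" "\<alpha> ^ n = A"
    and \<phi>: "self_map unit_disc \<phi>"
    and aff: "\<forall>z\<in>unit_disc. cayley \<tau> (\<phi> z) = of_real A * cayley \<tau> z + B"
    and g_def: "g = (\<lambda>w. of_real \<alpha> * w + B / of_real (\<Sum>j<n. \<alpha> ^ j))"
    and f_def: "f = (\<lambda>z. cayley_inv \<tau> (g (cayley \<tau> z)))"
  shows "self_map unit_disc f" and "\<And>z. z \<in> unit_disc \<Longrightarrow> (f ^^ n) z = \<phi> z"
    and "\<And>z. z \<in> unit_disc \<Longrightarrow> cayley \<tau> (f z) = g (cayley \<tau> z)"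
    and "\<And>z. z \<in> unit_disc \<Longrightarrow> f z = \<tau> * ((g (cayley \<tau> z) - 1) / (g (cayley \<tau> z) + 1))"
proof -
  have S: "(\<Sum>j<n. \<alpha> ^ j) > 0" using \<alpha> n by (intro sum_pos) auto
  have gH: "Re (g (cayley \<tau> z)) > 0" if "z \<in> unit_disc" for z
    using Re_cayley_pos[OF \<tau> that] \<alpha> B S
    by (simp add: g_def Re_divide_of_real add_pos_nonneg del: of_real_sum)
  have fD: "f z \<in> unit_disc" if "z \<in> unit_disc" for z
    unfolding f_def using cayley_inv_in_disc[OF \<tau> gH[OF that]] .
  have "(\<lambda>z. g (cayley \<tau> z)) holomorphic_on unit_disc"
    unfolding g_def by (intro holomorphic_intros cayley_holomorphic \<tau>) (use S in auto)
  then have "cayley_inv \<tau> \<circ> (\<lambda>z. g (cayley \<tau> z)) holomorphic_on unit_disc"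
    by (rule holomorphic_on_compose_gen[OF _ cayley_inv_holomorphic[OF \<tau>]]) (use gH in auto)
  then show f: "self_map unit_disc f"
    using fD by (simp add: self_map_def f_def o_def image_subset_iff)
  show conj: "cayley \<tau> (f z) = g (cayley \<tau> z)" if "z \<in> unit_disc" for z
    unfolding f_def using cayley_cayley_inv[OF \<tau> gH[OF that]] .
  show "f z = \<tau> * ((g (cayley \<tau> z) - 1) / (g (cayley \<tau> z) + 1))" if "z \<in> unit_disc" for z
    unfolding f_def using cayley_inv_formula[OF \<tau> gH[OF that]] .
  show "(f ^^ n) z = \<phi> z" if z: "z \<in> unit_disc" for z
  proof -
    have fk: "(f ^^ k) z \<in> unit_disc" for k using self_map_mem[OF self_map_funpow[OF f] z] .
    have "cayley \<tau> ((f ^^ k) z) = (g ^^ k) (cayley \<tau> z)" for k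
      by (induction k) (simp_all add: conj[OF fk])
    then have "cayley \<tau> ((f ^^ n) z)
        = of_real A * cayley \<tau> z + B / of_real (\<Sum>j<n. \<alpha> ^ j) * of_real (\<Sum>j<n. \<alpha> ^ j)"
      by (simp only: g_def funpow_real_affine \<alpha>(2))
    also have "\<dots> = of_real A * cayley \<tau> z + B"
      using S by (simp del: of_real_sum)
    finally have "cayley_inv \<tau> (cayley \<tau> ((f ^^ n) z)) = cayley_inv \<tau> (cayley \<tau> (\<phi> z))"
      using aff z by simp
    then show ?thesis using fk self_map_mem[OF \<phi> z] by (simp only: cayley_inv_cayley[OF \<tau>])
  qed
qed

theorem theorem9:
  fixes n :: nat and \<phi> :: "complex \<Rightarrow> complex"
  assumes "n > 0"
    and "linear_fractional_self_map \<phi>"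
    and "parabolic \<phi> \<or> hyperbolic \<phi>"
  shows "\<exists>f. self_map unit_disc f \<and> (\<forall>z\<in>unit_disc. (f ^^ n) z = \<phi> z) \<and>
     (\<forall>h. self_map unit_disc h \<and> (\<forall>z\<in>unit_disc. (h ^^ n) z = \<phi> z) \<longrightarrow>
        (\<forall>z\<in>unit_disc. h z = f z)) \<and>
     (parabolic \<phi> \<longrightarrow> parabolic f) \<and>
     (hyperbolic \<phi> \<longrightarrow> hyperbolic f) \<and>
     (\<exists>!\<tau>. denjoy_wolff_point \<phi> \<tau>) \<and>
     (\<forall>\<tau>. denjoy_wolff_point \<phi> \<tau> \<longrightarrow>
        self_map right_half_plane (cayley \<tau> \<circ> \<phi> \<circ> cayley_inv \<tau>) \<and>
        (\<exists>(A::real) (B::complex).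
           A \<ge> 1 \<and> Re B \<ge> 0 \<and>
           (\<forall>w\<in>right_half_plane. (cayley \<tau> \<circ> \<phi> \<circ> cayley_inv \<tau>) w = of_real A * w + B) \<and>
           (\<exists>!\<alpha>::real. \<alpha> > 0 \<and> \<alpha> ^ n = A) \<and>
           (\<forall>\<alpha>::real. \<alpha> > 0 \<and> \<alpha> ^ n = A \<longrightarrow>
              (let g = (\<lambda>w. of_real \<alpha> * w + B / of_real (\<Sum>k=0..n-1. \<alpha> ^ k)) in
                 \<forall>z\<in>unit_disc.
                   f z = cayley_inv \<tau> (g (cayley \<tau> z)) \<and>
                   f z = \<tau> * ((g ((\<tau> + z) / (\<tau> - z)) - 1) / (g ((\<tau> + z) / (\<tau> - z)) + 1))))))"
proof -
  obtain \<tau> where dw: "denjoy_wolff_point \<phi> \<tau>"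
    using assms(3) by (auto simp: parabolic_def hyperbolic_def)
  have \<tau>: "norm \<tau> = 1" using denjoy_wolff_point_norm[OF dw] .
  have sm: "self_map unit_disc \<phi>" and nofix: "\<And>z. z \<in> unit_disc \<Longrightarrow> \<phi> z \<noteq> z"
    using dw by (auto simp: denjoy_wolff_point_def)
  have smH: "self_map right_half_plane (cayley \<tau> \<circ> \<phi> \<circ> cayley_inv \<tau>)"
    using self_map_cayley_conjugate[OF \<tau> sm] .
  obtain A' B where aff': "\<And>z. z \<in> unit_disc \<Longrightarrow> cayley \<tau> (\<phi> z) = A' * cayley \<tau> z + B"
    using linear_fractional_cayley_affine[OF assms(2) dw] by blast
  have conj': "(cayley \<tau> \<circ> \<phi> \<circ> cayley_inv \<tau>) w = A' * w + B" if "Re w > 0" for w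
    using aff'[OF cayley_inv_in_disc[OF \<tau> that]] cayley_cayley_inv[OF \<tau> that] by simp
  then have "Re (A' * w + B) > 0" if "Re w > 0" for w
    using self_map_mem[OF smH, of w] that by simp
  note coeffs = affine_half_plane_coefficients[OF this]
  define A where "A = Re A'"
  have A': "A' = of_real A" using coeffs(1) by (simp add: A_def complex_eq_iff)
  have B: "Re B \<ge> 0" by (rule coeffs(3))
  have aff: "cayley \<tau> (\<phi> z) = of_real A * cayley \<tau> z + B" if "z \<in> unit_disc" for z
    using aff'[OF that] by (simp add: A')
  have conj: "\<forall>w\<in>right_half_plane. (cayley \<tau> \<circ> \<phi> \<circ> cayley_inv \<tau>) w = of_real A * w + B"
    using conj' by (simp add: A')
  have A: "A \<ge> 1" using cayley_affine_multiplier_ge_1[OF dw _ aff] coeffs(2) by (simp add: A_def)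

  define \<alpha> where "\<alpha> = root n A"
  have \<alpha>: "\<alpha> > 0" "\<alpha> ^ n = A" using A assms(1) by (simp_all add: \<alpha>_def)
  have \<alpha>_unique: "a = \<alpha>" if "a > 0 \<and> a ^ n = A" for a
    using that \<alpha> assms(1) by (metis less_imp_le power_eq_imp_eq_base)
  have \<alpha>1: "\<alpha> \<ge> 1" using A assms(1) by (simp add: \<alpha>_def)
  define g where "g = (\<lambda>w. of_real \<alpha> * w + B / of_real (\<Sum>j<n. \<alpha> ^ j))"
  define f where "f = (\<lambda>z. cayley_inv \<tau> (g (cayley \<tau> z)))"
  have "\<forall>z\<in>unit_disc. cayley \<tau> (\<phi> z) = of_real A * cayley \<tau> z + B" using aff by blast
  note f_facts = disc_root_of_affine_exists[OF assms(1) \<tau> B \<alpha> sm this g_def f_def]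
  have f_unique: "h z = f z"
    if h: "self_map unit_disc h" "\<forall>z\<in>unit_disc. (h ^^ n) z = \<phi> z" and z: "z \<in> unit_disc" for h z
  proof -
    have "cayley \<tau> (h z) = g (cayley \<tau> z)"
      unfolding g_def
      by (rule disc_root_of_affine_unique[OF assms(1) \<tau> A B \<alpha> nofix aff h(1) _ z]) (use h(2) in auto)
    then show ?thesis using cayley_inv_cayley[OF \<tau> self_map_mem[OF h(1) z]] by (simp add: f_def)
  qed
  have dw_f: "denjoy_wolff_point f \<tau>"
    using denjoy_wolff_point_root[OF f_facts(1) assms(1) f_facts(2) dw] .
  note aff_f = f_facts(3)[unfolded g_def]
  have parabolic: "parabolic f" if "parabolic \<phi>"
  proof -
    have "\<alpha> ^ n = 1 ^ n" using that parabolic_iff_multiplier[OF dw A aff] \<alpha>(2) by simp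
    then have "\<alpha> = 1" using \<alpha>(1) assms(1) by (metis less_imp_le power_eq_imp_eq_base zero_le_one)
    then show ?thesis using parabolic_iff_multiplier[OF dw_f \<alpha>1 aff_f] by blast
  qed
  have hyperbolic: "hyperbolic f" if "hyperbolic \<phi>"
  proof -
    have "\<alpha> ^ n \<noteq> 1" using that hyperbolic_iff_multiplier[OF dw A aff] \<alpha>(2) by simp
    then have "\<alpha> \<noteq> 1" by auto
    then show ?thesis using hyperbolic_iff_multiplier[OF dw_f \<alpha>1 aff_f] \<alpha>1 by simp
  qed
  have sum: "{0..n - 1} = {..<n}" using assms(1) by auto
  have formula: "f z = cayley_inv \<tau> (g (cayley \<tau> z)) \<and>
      f z = \<tau> * ((g ((\<tau> + z) / (\<tau> - z)) - 1) / (g ((\<tau> + z) / (\<tau> - z)) + 1))"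
    if "z \<in> unit_disc" for z
    using f_facts(4)[OF that] by (simp add: f_def cayley_def)
  show ?thesis
  proof (intro exI[of _ f] conjI allI impI)
    show "self_map unit_disc f" by (rule f_facts(1))
    show "\<forall>z\<in>unit_disc. (f ^^ n) z = \<phi> z" using f_facts(2) by blast
    show "\<exists>!\<tau>. denjoy_wolff_point \<phi> \<tau>" using dw denjoy_wolff_point_unique by blast
    fix \<sigma> assume "denjoy_wolff_point \<phi> \<sigma>"
    then have \<sigma>: "\<sigma> = \<tau>" using dw denjoy_wolff_point_unique by blast
    show "self_map right_half_plane (cayley \<sigma> \<circ> \<phi> \<circ> cayley_inv \<sigma>)" unfolding \<sigma> by (rule smH)
    show "\<exists>(A::real) (B::complex).
           A \<ge> 1 \<and> Re B \<ge> 0 \<and>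
           (\<forall>w\<in>right_half_plane. (cayley \<sigma> \<circ> \<phi> \<circ> cayley_inv \<sigma>) w = of_real A * w + B) \<and>
           (\<exists>!\<alpha>::real. \<alpha> > 0 \<and> \<alpha> ^ n = A) \<and>
           (\<forall>\<alpha>::real. \<alpha> > 0 \<and> \<alpha> ^ n = A \<longrightarrow>
              (let g = (\<lambda>w. of_real \<alpha> * w + B / of_real (\<Sum>k=0..n-1. \<alpha> ^ k)) in
                 \<forall>z\<in>unit_disc.
                   f z = cayley_inv \<sigma> (g (cayley \<sigma> z)) \<and>
                   f z = \<sigma> * ((g ((\<sigma> + z) / (\<sigma> - z)) - 1) / (g ((\<sigma> + z) / (\<sigma> - z)) + 1))))"
      unfolding \<sigma> Let_def sum
    proof (rule exI[of _ A], rule exI[of _ B], intro conjI)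
      show "\<exists>!\<alpha>. \<alpha> > 0 \<and> \<alpha> ^ n = A" using \<alpha> \<alpha>_unique by blast
    qed (use A B conj formula[unfolded g_def] \<alpha>_unique in blast)+
  qed (use f_unique parabolic hyperbolic in blast)+
qed

end
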